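(* Let $\mathtt{Compress}:\Sigma^*\to(\Sigma')^*$ be the (non-overlapping) LZ77 compression function with sliding window size $W\le n$, as described in the context. Then, for strings of length $n$, $$\mathrm{GS}_{\mathtt{Compress}}\le\Big(\tfrac{\sqrt[3]{81}}{2}W^{2/3}+\tfrac{\sqrt[3]{9}}{2}W^{1/3}+3\Big)\big(2\lceil\log n\rceil+\lceil\log|\Sigma|\rceil\big)=O(W^{2/3}\log n).$$
   Context: All logarithms are base 2. For $w\in\Sigma^n$, $w[i]$ is its $i$-th character and $w[a,b]$ the substring from position $a$ to $b$. Non-overlapping LZ77 with window $W\le n$: the output on $w\in\Sigma^n$ is a sequence of blocks $B_1,\dots,B_t$, $B_i=[q_i,\ell_i,c_i]$ with integers $0\le q_i,\ell_i<n$ and $c_i\in\Sigma$; set $s_i=1+\sum_{r<i}(\ell_r+1)$ and $f_i=s_i+\ell_i$, so $B_i$ encodes $w[s_i,f_i]$. Greedily, $B_1=[0,0,w[1]]$; if the first $\mathsf{ctc}<n$ characters have been encoded, the next block uses the largest $\ell\ge 0$ (with $\mathsf{ctc}+\ell<n$) such that $w[\mathsf{ctc}+1,\mathsf{ctc}+\ell]=w[z-\ell+1,z]$ for some $z$ with $\max\{0,\mathsf{ctc}-W\}+\ell\le z\le\mathsf{ctc}$; if $\ell=0$ the block is $[0,0,w[\mathsf{ctc}+1]]$, otherwise it is $[z-\ell+1,\ell,w[\mathsf{ctc}+\ell+1]]$; then $\mathsf{ctc}$ increases by $\ell+1$, and the algorithm stops when $\mathsf{ctc}=n$. Each block is encoded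 with $2\lceil\log n\rceil+\lceil\log|\Sigma|\rceil$ bits, so $|\mathtt{Compress}(w)|=t(2\lceil\log n\rceil+\lceil\log|\Sigma|\rceil)$. Strings $w,w'\in\Sigma^n$ are neighbors ($w\sim w'$) if they differ in exactly one position, and $\mathrm{GS}_{\mathtt{Compress}}=\max_{w\in\Sigma^n}\max_{w'\sim w}\big||\mathtt{Compress}(w)|-|\mathtt{Compress}(w')|\big|$. *)

theory Defs
  imports "HOL-Library.Landau_Symbols" "HOL-Library.Countable_Set" "HOL-Library.Cardinality"
begin

text \<open>Strings over the alphabet are lists over a finite type; positions are 1-based, so the
  \<open>i\<close>-th character of \<open>w\<close> is \<open>w ! (i - 1)\<close>, and \<open>substr w a b\<close> is empty if \<open>b < a\<close>.\<close>

definition substr :: "'a list \<Rightarrow> nat \<Rightarrow> nat \<Rightarrow> 'a list" where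
  "substr w a b = take (Suc b - a) (drop (a - 1) w)"

text \<open>\<open>c\<close> is the number of characters encoded so far. Subtraction is truncated, so \<open>c - W\<close> is
  the maximum of \<open>0\<close> and the integer difference.\<close>

definition lz77_source :: "nat \<Rightarrow> 'a list \<Rightarrow> nat \<Rightarrow> nat \<Rightarrow> nat \<Rightarrow> bool" where
  "lz77_source W w c l z \<longleftrightarrow>
     (c - W) + l \<le> z \<and> z \<le> c \<and> substr w (c + 1) (c + l) = substr w (z - l + 1) z"

definition lz77_match :: "nat \<Rightarrow> 'a list \<Rightarrow> nat \<Rightarrow> nat" where
  "lz77_match W w c = Max {l. c + l < length w \<and> (\<exists>z. lz77_source W w c l z)}"

text \<open>The choice among several longest matches is left unspecified (but is a function of the
  window, the string and the current position).\<close>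

definition lz77_block :: "nat \<Rightarrow> 'a list \<Rightarrow> nat \<Rightarrow> nat \<times> nat \<times> 'a" where
  "lz77_block W w c =
     (let l = lz77_match W w c in
      if l = 0 then (0, 0, w ! c)
      else ((SOME z. lz77_source W w c l z) - l + 1, l, w ! (c + l)))"

function lz77_from :: "nat \<Rightarrow> 'a list \<Rightarrow> nat \<Rightarrow> (nat \<times> nat \<times> 'a) list" where
  "lz77_from W w c =
     (if c < length w then lz77_block W w c # lz77_from W w (c + lz77_match W w c + 1) else [])"
  by pat_completeness auto
termination
  by (relation "measure (\<lambda>(W, w, c). length w - c)") auto

declare lz77_from.simps [simp del]

text \<open>The initial block \<open>(0, 0, w ! 0)\<close> needs no special treatment: at \<open>c = 0\<close> the only
  admissible match length is \<open>0\<close>.\<close>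

definition lz77_blocks :: "nat \<Rightarrow> 'a list \<Rightarrow> (nat \<times> nat \<times> 'a) list" where
  "lz77_blocks W w = lz77_from W w 0"

text \<open>Fixed-width binary encoding of the blocks of a string of length \<open>n\<close>; characters are
  numbered \<open>0, \<dots>, CARD('a) - 1\<close> by \<open>to_nat_on UNIV\<close>.\<close>

definition fixed_width_bits :: "nat \<Rightarrow> nat \<Rightarrow> bool list" where
  "fixed_width_bits k m = map (\<lambda>i. bit m i) [0..<k]"

definition encode_block :: "nat \<Rightarrow> nat \<times> nat \<times> 'a::finite \<Rightarrow> bool list" where
  "encode_block n b = (case b of (q, l, x) \<Rightarrow>
     fixed_width_bits (nat \<lceil>log 2 (real n)\<rceil>) q @
     fixed_width_bits (nat \<lceil>log 2 (real n)\<rceil>) l @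
     fixed_width_bits (nat \<lceil>log 2 (real CARD('a))\<rceil>) (to_nat_on (UNIV :: 'a set) x))"

definition compress :: "nat \<Rightarrow> 'a::finite list \<Rightarrow> bool list" where
  "compress W w = concat (map (encode_block (length w)) (lz77_blocks W w))"

lemma length_compress:
  fixes w :: "'a::finite list"
  shows "int (length (compress W w)) =
    int (length (lz77_blocks W w)) *
      (2 * \<lceil>log 2 (real (length w))\<rceil> + \<lceil>log 2 (real CARD('a))\<rceil>)"
proof (cases "w = []")
  case True
  then show ?thesis
    by (simp add: compress_def lz77_blocks_def lz77_from.simps)
next
  case False
  have n: "0 \<le> \<lceil>log 2 (real (length w))\<rceil>"
    using False by (simp add: Suc_le_eq order_less_le_trans [of _ 0])
  have "1 \<le> CARD('a)"
    by (simp add: Suc_leI)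
  then have k: "0 \<le> \<lceil>log 2 (real CARD('a))\<rceil>"
    by (simp add: order_less_le_trans [of _ 0])
  have b: "length (encode_block (length w) b) =
      2 * nat \<lceil>log 2 (real (length w))\<rceil> + nat \<lceil>log 2 (real CARD('a))\<rceil>"
    for b :: "nat \<times> nat \<times> 'a"
    by (cases b) (simp add: encode_block_def fixed_width_bits_def)
  show ?thesis
    using n k by (simp add: compress_def length_concat o_def b sum_list_triv)
qed

definition neighbors :: "'a list \<Rightarrow> 'a list \<Rightarrow> bool" where
  "neighbors w w' \<longleftrightarrow>
     length w = length w' \<and> card {i. i < length w \<and> w ! i \<noteq> w' ! i} = 1"

text \<open>Inserting \<open>0\<close> only matters if there are no neighbouring strings of length \<open>n\<close>
  (\<open>n = 0\<close> or a one-letter alphabet), where the maximum over the empty set is taken to be \<open>0\<close>.\<close>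

definition global_sensitivity :: "('a::finite list \<Rightarrow> 'b list) \<Rightarrow> nat \<Rightarrow> int" where
  "global_sensitivity f n =
     Max (insert 0 {\<bar>int (length (f w)) - int (length (f w'))\<bar> | w w'.
       length w = n \<and> neighbors w w'})"

end

theory Submission
  imports Defs
begin

text \<open>Let \<open>w\<close> and \<open>w'\<close> differ only at \<open>p\<close>. Every block of \<open>w\<close> contains the start of at most one block
  of \<open>w'\<close> that does not end strictly before it, so \<open>w'\<close> has at most as many extra blocks as there
  are blocks \<open>[y, y + L)\<close> of \<open>w'\<close> lying inside the copied part of a block of \<open>w\<close>. Such a block
  inherits a source \<open>[b, b + L)\<close> in \<open>w\<close>, and \<open>p\<close> lies in the block (at most one such block) or in its
  source, since otherwise the greedy choice for \<open>w'\<close> would be longer. In the latter case \<open>(L, b)\<close>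
  determines the block, as a repetition could be copied from the first occurrence; hence there are at
  most \<open>L\<close> blocks of each length \<open>L\<close>, all disjoint and starting in \<open>(p, p + W]\<close>. For any threshold
  \<open>k\<close> there are thus at most \<open>k (k + 1) / 2\<close> blocks with \<open>L \<le> k\<close> and \<open>W / (k + 1) + 1\<close> longer ones,
  and \<open>k = \<lfloor>root 3 W\<rfloor>\<close> yields \<open>3/2 W\<^sup>2\<^sup>/\<^sup>3 + 1/2 W\<^sup>1\<^sup>/\<^sup>3 + 2\<close>, which is below the stated bound.\<close>

section \<open>Orbits of inflationary maps\<close>

text \<open>For the map from each block start to the next, this is the set of block starts in a
  string of length \<open>n\<close>; block counts become cardinalities.\<close>

definition orbit_below :: "nat \<Rightarrow> (nat \<Rightarrow> nat) \<Rightarrow> nat \<Rightarrow> nat set" where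
  "orbit_below n g c = {x. x < n \<and> (\<exists>k. x = (g ^^ k) c)}"

lemma finite_orbit_below [simp]: "finite (orbit_below n g c)"
  unfolding orbit_below_def by (rule finite_subset [of _ "{..<n}"]) auto

lemma orbit_below_closed: "x \<in> orbit_below n g c \<Longrightarrow> g x < n \<Longrightarrow> g x \<in> orbit_below n g c"
  unfolding orbit_below_def by (auto intro: exI [of _ "Suc _"])

lemma orbit_below_step:
  assumes infl: "\<And>x. x < g x" and "x \<in> orbit_below n g c" "y \<in> orbit_below n g c" "x < y"
  shows "g x \<le> y"
proof -
  have mono: "strict_mono (\<lambda>k. (g ^^ k) c)"
    by (simp add: strict_mono_Suc_iff infl)
  obtain i j where ij: "x = (g ^^ i) c" "y = (g ^^ j) c"
    using assms by (auto simp: orbit_below_def)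
  then have "Suc i \<le> j"
    using \<open>x < y\<close> strict_mono_less [OF mono] by (simp add: Suc_le_eq)
  then have "(g ^^ Suc i) c \<le> (g ^^ j) c"
    by (rule strict_mono_leD [OF mono])
  then show ?thesis by (simp add: ij)
qed

lemma orbit_below_unfold:
  assumes infl: "\<And>x. x < g x" and "c < n"
  shows "orbit_below n g c = insert c (orbit_below n g (g c))" and "c \<notin> orbit_below n g (g c)"
proof -
  have "x = c \<or> (\<exists>k. x = (g ^^ k) (g c))" if "x = (g ^^ k) c" for x k
    using that by (cases k) (auto simp: funpow_swap1)
  moreover have "\<exists>k'. (g ^^ k) (g c) = (g ^^ k') c" for k
    by (rule exI [of _ "Suc k"]) (simp add: funpow_swap1)
  moreover have "\<exists>k. c = (g ^^ k) c"
    by (rule exI [of _ 0]) simp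
  ultimately show "orbit_below n g c = insert c (orbit_below n g (g c))"
    using \<open>c < n\<close> unfolding orbit_below_def by blast
  have "c < (g ^^ k) (g c)" for k
    by (induction k) (auto intro: infl less_trans [OF _ infl])
  then have "c \<noteq> (g ^^ k) (g c)" for k
    by (metis less_irrefl)
  then show "c \<notin> orbit_below n g (g c)"
    unfolding orbit_below_def by blast
qed

text \<open>Among the intervals \<open>[y, h y)\<close> starting inside a given \<open>[x, g x)\<close>, all but the last one end
  before \<open>g x\<close>.\<close>

lemma card_orbit_below_le:
  assumes g: "\<And>x. x < g x" and h: "\<And>x. x < h x"
  shows "card (orbit_below n h c) \<le> card (orbit_below n g c) +
    card {y \<in> orbit_below n h c. \<exists>x \<in> orbit_below n g c. x \<le> y \<and> h y < g x}"
    (is "card ?B \<le> card ?A + card ?bad")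
proof -
  \<comment> \<open>\<open>r y\<close> is the start of the \<open>g\<close>-interval around
    \<open>y\<close>; it turns out to be injective outside \<open>?bad\<close>.\<close>
  define r where "r y = Max {x \<in> ?A. x \<le> y}" for y
  have ge: "c \<le> y" if "y \<in> ?B" for y
  proof -
    have "c \<le> (h ^^ k) c" for k
      by (induction k) (auto intro: order_trans [OF _ less_imp_le [OF h]])
    then show ?thesis using that by (auto simp: orbit_below_def)
  qed
  have r: "r y \<in> ?A" "r y \<le> y" if "y \<in> ?B" for y
  proof -
    have "c \<in> {x \<in> ?A. x \<le> y}"
      using ge [OF that] that by (auto simp: orbit_below_def intro: exI [of _ 0])
    then have "r y \<in> {x \<in> ?A. x \<le> y}"
      unfolding r_def by (intro Max_in) auto
    then show "r y \<in> ?A" "r y \<le> y" by auto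
  qed
  have r_max: "x \<le> r y" if "x \<in> ?A" "x \<le> y" for x y
    unfolding r_def using that by (intro Max_ge) auto
  \<comment> \<open>As \<open>y\<close> is not bad, its interval reaches \<open>g (r y)\<close>, and
    \<open>y'\<close> starts no earlier. So \<open>g (r y)\<close> is a larger candidate for
    \<open>r y'\<close>.\<close>
  have clash: False
    if y: "y \<in> ?B - ?bad" "y' \<in> ?B - ?bad" and eq: "r y = r y'" and less: "y < y'" for y y'
  proof -
    have "g (r y) \<le> h y" using y r [of y] by force
    also have "h y \<le> y'" using orbit_below_step [OF h] y less by blast
    finally have le: "g (r y) \<le> y'" .
    then have "g (r y) \<in> ?A"
      using r [of y] y by (intro orbit_below_closed) (auto simp: orbit_below_def)
    then have "g (r y) \<le> r y" using r_max le eq by metis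
    then show False using g [of "r y"] by simp
  qed
  have "inj_on r (?B - ?bad)"
    using clash by (intro linorder_inj_onI') blast
  then have "card (?B - ?bad) \<le> card ?A"
    by (rule card_inj_on_le) (use r in auto)
  moreover have "card (?B - ?bad) = card ?B - card ?bad"
    by (rule card_Diff_subset) auto
  ultimately show ?thesis by linarith
qed

section \<open>Greedy parsing\<close>

text \<open>Positions are 0-based here, and \<open>a\<close> is the start of the source rather than its end.\<close>

definition copyable :: "nat \<Rightarrow> 'a list \<Rightarrow> nat \<Rightarrow> nat \<Rightarrow> nat \<Rightarrow> bool" where
  "copyable W w c l a \<longleftrightarrow> c - W \<le> a \<and> a + l \<le> c \<and> (\<forall>k<l. w ! (c + k) = w ! (a + k))"

text \<open>Take \<open>z = a + l\<close>. The length hypothesis gives both substrings full length,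
  so their equality is pointwise.\<close>

lemma lz77_source_iff_copyable:
  assumes "c + l < length w"
  shows "(\<exists>z. lz77_source W w c l z) \<longleftrightarrow> (\<exists>a. copyable W w c l a)"
proof -
  have eq: "take l (drop c w) = take l (drop a w) \<longleftrightarrow> (\<forall>k<l. w ! (c + k) = w ! (a + k))"
    if "a \<le> c" for a
    using that assms by (auto simp: list_eq_iff_nth_eq)
  have "lz77_source W w c l (a + l) \<longleftrightarrow> copyable W w c l a" for a
    using eq [of a] by (auto simp: lz77_source_def copyable_def substr_def)
  moreover have "z = (z - l) + l" if "lz77_source W w c l z" for z
    using that by (auto simp: lz77_source_def)
  ultimately show ?thesis by metis
qed

lemma lz77_match_eq:
  "lz77_match W w c = Max {l. c + l < length w \<and> (\<exists>a. copyable W w c l a)}"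
  unfolding lz77_match_def
  by (intro arg_cong [where f = Max] Collect_cong conj_cong refl lz77_source_iff_copyable)

lemma finite_copyable: "finite {l. c + l < length w \<and> (\<exists>a. copyable W w c l a)}"
  by (rule finite_subset [of _ "{..<length w}"]) auto

text \<open>The empty match is always admissible, so the \<open>Max\<close> is attained.\<close>

lemma lz77_match_copyable:
  assumes "c < length w"
  shows "c + lz77_match W w c < length w" and "\<exists>a. copyable W w c (lz77_match W w c) a"
proof -
  have "copyable W w c 0 c" by (simp add: copyable_def)
  then have "0 \<in> {l. c + l < length w \<and> (\<exists>a. copyable W w c l a)}"
    using assms by auto
  then have "lz77_match W w c \<in> {l. c + l < length w \<and> (\<exists>a. copyable W w c l a)}"
    unfolding lz77_match_eq by (intro Max_in finite_copyable) blast
  then show "c + lz77_match W w c < length w" "\<exists>a. copyable W w c (lz77_match W w c) a"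
    by auto
qed

lemma lz77_match_ge: "c + l < length w \<Longrightarrow> copyable W w c l a \<Longrightarrow> l \<le> lz77_match W w c"
  unfolding lz77_match_eq by (intro Max_ge finite_copyable) auto

definition lz77_next :: "nat \<Rightarrow> 'a list \<Rightarrow> nat \<Rightarrow> nat" where
  "lz77_next W w c = c + lz77_match W w c + 1"

lemma less_lz77_next: "c < lz77_next W w c"
  by (simp add: lz77_next_def)

text \<open>Each recursive call removes exactly the least point of the orbit.\<close>

lemma length_lz77_from:
  "length (lz77_from W w c) = card (orbit_below (length w) (lz77_next W w) c)"
proof (induction W w c rule: lz77_from.induct)
  case (1 W w c)
  show ?case
  proof (cases "c < length w")
    case True
    then have "length (lz77_from W w c) = Suc (length (lz77_from W w (lz77_next W w c)))"
      by (subst lz77_from.simps) (simp add: lz77_next_def)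
    then show ?thesis
      using 1 True orbit_below_unfold [of "lz77_next W w", OF less_lz77_next True]
      by (simp del: add_Suc_right One_nat_def flip: lz77_next_def)
  next
    case False
    have "c \<le> (lz77_next W w ^^ k) c" for k
      by (induction k) (auto intro: order_trans [OF _ less_imp_le [OF less_lz77_next]])
    then have "orbit_below (length w) (lz77_next W w) c = {}"
      using False unfolding orbit_below_def by (auto simp: not_less intro: order_trans)
    then show ?thesis using False by (simp add: lz77_from.simps)
  qed
qed

section \<open>Blocks properly contained in a block of the neighbour\<close>

text \<open>Shifting the source of the surrounding match by \<open>y - x\<close> gives a source at
  \<open>y\<close>; the window moves by at most as much.\<close>

lemma nested_block_copyable:
  assumes x: "x < length w" "x \<le> y" and nested: "y + L \<le> x + lz77_match W w x"
  shows "\<exists>b. copyable W w y L b"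
proof -
  obtain a where a: "copyable W w x (lz77_match W w x) a"
    using lz77_match_copyable [OF x(1)] by blast
  have "w ! (y + k) = w ! (a + (y - x) + k)" if "k < L" for k
  proof -
    have "y - x + k < lz77_match W w x"
      using nested that x(2) by linarith
    then have "w ! (x + (y - x + k)) = w ! (a + (y - x + k))"
      using a by (simp add: copyable_def)
    then show ?thesis using x(2) by (simp add: add.assoc)
  qed
  then have "copyable W w y L (a + (y - x))"
    using a nested x(2) unfolding copyable_def by auto
  then show ?thesis ..
qed

text \<open>An interval of length \<open>l\<close> around \<open>p\<close> has only \<open>l\<close>
  possible offsets \<open>p - b\<close>; sum over \<open>l \<le> k\<close>.\<close>

lemma card_short_le:
  fixes L b :: "nat \<Rightarrow> nat"
  assumes inj: "inj_on (\<lambda>y. (L y, b y)) N"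
    and N: "\<And>y. y \<in> N \<Longrightarrow> b y \<le> p \<and> p < b y + L y \<and> L y \<le> k"
  shows "card N \<le> k * (k + 1) div 2"
proof -
  let ?f = "\<lambda>y. (L y, p - b y)"
  have "inj_on ?f N"
  proof (rule inj_onI)
    fix y y' assume y: "y \<in> N" "y' \<in> N" and "?f y = ?f y'"
    then have "L y = L y'" "b y = b y'"
      using N [OF y(1)] N [OF y(2)] by auto
    then show "y = y'" using inj y by (auto simp: inj_on_def)
  qed
  then have "card N \<le> card (SIGMA l:{0..k}. {..<l})"
    by (rule card_inj_on_le) (use N in force)+
  also have "\<dots> = k * (k + 1) div 2"
    using gauss_sum_nat [of k] by simp
  finally show ?thesis .
qed

text \<open>Cut the positions from \<open>p\<close> on into cells of length \<open>k + 1\<close>: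
  separated points fall into distinct cells, numbered \<open>0\<close> to
  \<open>W div (k + 1)\<close>.\<close>

lemma card_separated_le:
  fixes N :: "nat set"
  assumes range: "\<And>y. y \<in> N \<Longrightarrow> p < y \<and> y \<le> p + W"
    and sep: "\<And>y y'. y \<in> N \<Longrightarrow> y' \<in> N \<Longrightarrow> y < y' \<Longrightarrow> y + (k + 1) \<le> y'"
  shows "card N \<le> W div (k + 1) + 1"
proof -
  let ?f = "\<lambda>y. (y - p) div (k + 1)"
  have less: "?f y < ?f y'" if "y \<in> N" "y' \<in> N" "y < y'" for y y'
  proof -
    have "y - p + (k + 1) \<le> y' - p"
      using range [OF that(1)] sep [OF that] by linarith
    then have "(y - p + (k + 1)) div (k + 1) \<le> ?f y'"
      by (rule div_le_mono)
    then show ?thesis by (subst (asm) div_add_self2) auto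
  qed
  have "inj_on ?f N"
    using less by (intro linorder_inj_onI') (metis less_irrefl)
  moreover have "?f ` N \<subseteq> {..W div (k + 1)}"
    using range by (force intro: div_le_mono)
  ultimately have "card N \<le> card {..W div (k + 1)}"
    by (rule card_inj_on_le) simp
  then show ?thesis by simp
qed

text \<open>The summand \<open>2\<close> is one for the block of \<open>w'\<close> containing
  \<open>p\<close> and one from the rounding in \<open>card_separated_le\<close>. One direction
  suffices, the hypotheses being symmetric in \<open>w\<close> and \<open>w'\<close>.\<close>

lemma lz77_blocks_diff_le:
  fixes w w' :: "'a list"
  assumes len: "length w = length w'" and differ: "\<And>i. i < length w \<Longrightarrow> i \<noteq> p \<Longrightarrow> w ! i = w' ! i"
  shows "length (lz77_blocks W w') \<le>
    length (lz77_blocks W w) + k * (k + 1) div 2 + W div (k + 1) + 2"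
proof -
  define n where "n = length w"
  define g where "g = lz77_next W w"
  define h where "h = lz77_next W w'"
  define A where "A = orbit_below n g 0"
  define B where "B = orbit_below n h 0"
  \<comment> \<open>The literal is counted too, so \<open>L y\<close> exceeds the longest match by
    one.\<close>
  define L where "L y = lz77_match W w' y + 1" for y
  define bad where "bad = {y \<in> B. \<exists>x \<in> A. x \<le> y \<and> h y < g x}"
  define R where "R y b \<longleftrightarrow> b \<le> p \<and> p < b + L y \<and> copyable W w y (L y) b" for y b
  define Q where "Q = {y \<in> B. y \<le> p \<and> p < h y}"
  \<comment> \<open>A match must leave room for a literal, so greediness yields no contradiction for
    a block ending at \<open>n\<close>; hence the strict bound.\<close>
  define N where "N = {y \<in> B. y + L y < n \<and> (\<exists>b. R y b)}"
  have h: "h y = y + L y" for y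
    by (simp add: h_def L_def lz77_next_def)
  have step: "y + L y \<le> y'" if "y \<in> B" "y' \<in> B" "y < y'" for y y'
    using orbit_below_step [of h] that h unfolding B_def by (metis h_def less_lz77_next)
  have fin: "finite B" by (simp add: B_def)
  have not_copy: "\<not> copyable W w' y (L y) b" if "y + L y < n" for y b
    using lz77_match_ge [of y "L y" w' W b] that len by (auto simp: L_def n_def)
  have "bad \<subseteq> Q \<union> N"
  proof
    fix y assume "y \<in> bad"
    then obtain x where x: "y \<in> B" "x \<in> A" "x \<le> y" "h y < g x"
      by (auto simp: bad_def)
    then have xn: "x < length w" by (simp add: A_def orbit_below_def n_def)
    \<comment> \<open>The strict inequality \<open>h y < g x\<close> keeps the block off the literal
      that ends the block at \<open>x\<close>.\<close>
    have nested: "y + L y \<le> x + lz77_match W w x"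
      using x(4) unfolding h by (simp add: g_def lz77_next_def)
    then have yn: "y + L y < n"
      using lz77_match_copyable(1) [OF xn, of W] by (simp add: n_def)
    obtain b where b: "copyable W w y (L y) b"
      using nested_block_copyable [OF xn x(3) nested] by blast
    show "y \<in> Q \<union> N"
    proof (rule ccontr)
      assume "y \<notin> Q \<union> N"
      \<comment> \<open>Now \<open>w\<close> and \<open>w'\<close> agree on the block and on its
        source, so the copy carries over to \<open>w'\<close> and beats the greedy match.\<close>
      then have out: "\<not> (y \<le> p \<and> p < y + L y)" "\<not> (b \<le> p \<and> p < b + L y)"
        using x(1) yn b by (auto simp: Q_def N_def R_def h)
      have "w' ! (y + k) = w' ! (b + k)" if "k < L y" for k
      proof -
        have "w ! (y + k) = w' ! (y + k)"
          using that yn out by (intro differ) (auto simp: n_def)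
        moreover have "w ! (b + k) = w' ! (b + k)"
          using that yn out b by (intro differ) (auto simp: n_def copyable_def)
        ultimately show ?thesis using b that by (simp add: copyable_def)
      qed
      then have "copyable W w' y (L y) b" using b by (simp add: copyable_def)
      then show False using not_copy yn by blast
    qed
  qed
  moreover have finQN: "finite Q" "finite N" using fin by (auto simp: Q_def N_def)
  ultimately have "card bad \<le> card Q + card N"
    by (meson card_Un_le card_mono finite_UnI le_trans)
  moreover have "card Q \<le> 1"
  proof -
    have "\<not> y < y'" if "y \<in> Q" "y' \<in> Q" for y y'
      using step [of y y'] that by (auto simp: Q_def h)
    then have "y = y'" if "y \<in> Q" "y' \<in> Q" for y y'
      using that by (metis linorder_neqE_nat)
    then show ?thesis using finQN by (simp add: card_le_Suc0_iff_eq)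
  qed
  moreover have "card N \<le> k * (k + 1) div 2 + (W div (k + 1) + 1)"
  proof -
    define b where "b y = (SOME b. R y b)" for y
    have b: "R y (b y)" if "y \<in> N" for y
      using that unfolding N_def b_def by (auto intro: someI)
    \<comment> \<open>The source contains \<open>p\<close>, ends no later than \<open>y\<close> and
      starts within the window of \<open>y\<close>.\<close>
    have range: "p < y \<and> y \<le> p + W" if "y \<in> N" for y
      using b [OF that] by (auto simp: R_def copyable_def)
    \<comment> \<open>Both blocks repeat the same stretch of \<open>w\<close> and lie to the right
      of \<open>p\<close>, so they agree in \<open>w'\<close> too, and the later one could be copied
      whole from the earlier.\<close>
    have clash: False
      if y: "y \<in> N" "y' \<in> N" "y < y'" and eq: "L y = L y'" "b y = b y'" for y y'
    proof -
      have le: "y + L y \<le> y'" using step y by (auto simp: N_def)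
      have y'n: "y' + L y' < n" using y by (simp add: N_def)
      have "w' ! (y' + k) = w' ! (y + k)" if k: "k < L y'" for k
      proof -
        have "w ! (y' + k) = w' ! (y' + k)" "w ! (y + k) = w' ! (y + k)"
          using k y'n y range [OF y(1)] by (auto intro!: differ simp: n_def)
        then show ?thesis
          using b [OF y(1)] b [OF y(2)] k eq by (simp add: R_def copyable_def)
      qed
      \<comment> \<open>The window of \<open>y'\<close> reaches back to \<open>b y'\<close>, which
        is at most \<open>p\<close> and hence left of \<open>y\<close>.\<close>
      moreover have "y' - W \<le> y"
        using b [OF y(2)] range [OF y(1)] by (auto simp: R_def copyable_def)
      ultimately have "copyable W w' y' (L y') y"
        using le eq by (simp add: copyable_def)
      then show False using not_copy y'n by blast
    qed
    have inj: "inj_on (\<lambda>y. (L y, b y)) N"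
      using clash by (intro linorder_inj_onI') blast
    have "card {y \<in> N. L y \<le> k} \<le> k * (k + 1) div 2"
      by (rule card_short_le [where L = L and b = b and p = p])
        (use b in \<open>auto simp: R_def intro: inj_on_subset [OF inj]\<close>)
    moreover have "card {y \<in> N. k < L y} \<le> W div (k + 1) + 1"
    proof (rule card_separated_le)
      fix y y' assume "y \<in> {y \<in> N. k < L y}" "y' \<in> {y \<in> N. k < L y}" "y < y'"
      then show "y + (k + 1) \<le> y'" using step [of y y'] by (auto simp: N_def)
    qed (use range in auto)
    moreover have "N = {y \<in> N. L y \<le> k} \<union> {y \<in> N. k < L y}" by auto
    then have "card N \<le> card {y \<in> N. L y \<le> k} + card {y \<in> N. k < L y}"
      by (metis card_Un_le)
    ultimately show ?thesis by linarith
  qed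
  moreover have "card B \<le> card A + card bad"
    unfolding A_def B_def bad_def
    by (rule card_orbit_below_le) (auto simp: g_def h_def less_lz77_next)
  moreover have "length (lz77_blocks W w) = card A" "length (lz77_blocks W w') = card B"
    using len by (simp_all add: lz77_blocks_def length_lz77_from A_def B_def g_def h_def n_def)
  ultimately show ?thesis by linarith
qed

section \<open>Bounds on the sensitivity\<close>

definition lz77_bound :: "nat \<Rightarrow> real" where
  "lz77_bound W = root 3 81 / 2 * real W powr (2/3) + root 3 9 / 2 * real W powr (1/3) + 3"

lemma lz77_bound_nonneg: "0 \<le> lz77_bound W"
  by (simp add: lz77_bound_def)

text \<open>With \<open>u = W powr (1/3)\<close>, this \<open>k\<close> balances both counts at
  order \<open>u^2\<close>: the total is at most \<open>(u^2 + u) / 2 + u^2 + 2\<close>.\<close>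

lemma threshold_le_lz77_bound:
  fixes W :: nat
  defines "k \<equiv> nat \<lfloor>real W powr (1/3)\<rfloor>"
  shows "real (k * (k + 1) div 2 + W div (k + 1) + 2) \<le> lz77_bound W"
proof -
  define u where "u = real W powr (1/3)"
  have u0: "0 \<le> u" by (simp add: u_def)
  have u2: "real W powr (2/3) = u\<^sup>2"
    by (simp add: u_def powr_powr power2_eq_square flip: powr_add)
  have u3: "real W = u ^ 3"
    by (cases "W = 0") (simp_all add: u_def powr_power)
  have k: "real k \<le> u" "u < real k + 1"
    using u0 by (auto simp: k_def u_def)
  have "real (k * (k + 1) div 2) \<le> real (k * (k + 1)) / 2"
    using of_nat_div_le_of_nat [of "k * (k + 1)" 2, where 'a = real] by simp
  also have "real (k * (k + 1)) \<le> u * (u + 1)"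
    using k u0 by (simp only: of_nat_mult of_nat_add of_nat_1) (intro mult_mono, auto)
  finally have 1: "real (k * (k + 1) div 2) \<le> (u\<^sup>2 + u) / 2"
    by (simp add: power2_eq_square algebra_simps)
  have "real (W div (k + 1)) \<le> real W / (real k + 1)"
    using of_nat_div_le_of_nat [of W "k + 1", where 'a = real] by (simp add: add.commute)
  also have "\<dots> \<le> u\<^sup>2"
  proof -
    have "u ^ 3 \<le> u\<^sup>2 * (real k + 1)"
      using k u0 by (simp add: power3_eq_cube power2_eq_square mult_left_mono)
    then show ?thesis using u3 by (simp add: divide_le_eq)
  qed
  finally have 2: "real (W div (k + 1)) \<le> u\<^sup>2" .
  \<comment> \<open>The quadratic terms add up to the coefficient \<open>3/2\<close>, which has to
    stay below \<open>root 3 81 / 2\<close>.\<close>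
  have "3 = root 3 27"
    by (rule real_root_pos_unique [symmetric]) auto
  also have "\<dots> \<le> root 3 81" by (rule real_root_le_mono) auto
  finally have "3 * u\<^sup>2 \<le> root 3 81 * u\<^sup>2"
    by (rule mult_right_mono) simp
  moreover have "1 * u \<le> root 3 9 * u"
    using u0 by (intro mult_right_mono) auto
  ultimately show ?thesis
    using 1 2 by (simp add: lz77_bound_def u2 flip: u_def)
qed

lemma neighbors_sym: "neighbors w w' \<Longrightarrow> neighbors w' w"
  by (simp add: neighbors_def eq_commute)

lemma neighbors_lz77_blocks_diff_le:
  assumes "neighbors w w'"
  shows "real (length (lz77_blocks W w')) - real (length (lz77_blocks W w)) \<le> lz77_bound W"
proof -
  from assms have len: "length w = length w'"
    by (simp add: neighbors_def)
  from assms obtain p where "{i. i < length w \<and> w ! i \<noteq> w' ! i} = {p}"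
    unfolding neighbors_def by (metis card_1_singletonE)
  then have "w ! i = w' ! i" if "i < length w" "i \<noteq> p" for i
    using that by blast
  from lz77_blocks_diff_le [OF len this, of p W "nat \<lfloor>real W powr (1/3)\<rfloor>"]
    threshold_le_lz77_bound [of W]
  show ?thesis by linarith
qed

lemma ceiling_log_nonneg: "0 \<le> \<lceil>log 2 (real n)\<rceil>"
proof (cases "n = 0")
  case False
  then have "0 \<le> log 2 (real n)" by simp
  then show ?thesis by linarith
\<comment> \<open>For \<open>n = 0\<close> the logarithm has the default value
  \<open>0\<close>.\<close>
qed (simp add: log_def)

text \<open>There are finitely many strings of length \<open>n\<close> over a finite alphabet, so
  the \<open>Max\<close> belongs to its set.\<close>

lemma global_sensitivity_attained:
  fixes f :: "'a::finite list \<Rightarrow> 'b list"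
  shows "global_sensitivity f n = 0 \<or>
    (\<exists>w w'. length w = n \<and> neighbors w w' \<and>
      global_sensitivity f n = \<bar>int (length (f w)) - int (length (f w'))\<bar>)"
  and "0 \<le> global_sensitivity f n"
proof -
  let ?S = "{\<bar>int (length (f w)) - int (length (f w'))\<bar> | w w'. length w = n \<and> neighbors w w'}"
  have "finite ({w :: 'a list. length w = n} \<times> {w :: 'a list. length w = n})"
    using finite_lists_length_eq [of "UNIV :: 'a set" n] by simp
  then have "finite ((\<lambda>(w, w'). \<bar>int (length (f w)) - int (length (f w'))\<bar>) `
      ({w. length w = n} \<times> {w. length w = n}))"
    by (rule finite_imageI)
  then have fin: "finite (insert 0 ?S)"
    by (rule finite.insertI [OF finite_subset, rotated]) (auto simp: neighbors_def)
  then have "global_sensitivity f n \<in> insert 0 ?S"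
    unfolding global_sensitivity_def by (intro Max_in) auto
  then show "global_sensitivity f n = 0 \<or> (\<exists>w w'. length w = n \<and> neighbors w w' \<and>
      global_sensitivity f n = \<bar>int (length (f w)) - int (length (f w'))\<bar>)"
    by blast
  show "0 \<le> global_sensitivity f n"
    unfolding global_sensitivity_def using fin by (intro Max_ge) auto
qed

text \<open>All blocks cost the same number of bits, so the bound on block counts, taken in both
  orders of the neighbours, is scaled by that number.\<close>

lemma global_sensitivity_compress_le:
  "real_of_int (global_sensitivity (compress W :: 'a::finite list \<Rightarrow> bool list) n) \<le>
    lz77_bound W * real_of_int (2 * \<lceil>log 2 (real n)\<rceil> + \<lceil>log 2 (real CARD('a))\<rceil>)"
    (is "?gs \<le> _ * real_of_int ?b")
proof -
  have b: "0 \<le> ?b" using ceiling_log_nonneg [of n] ceiling_log_nonneg [of "CARD('a)"] by linarith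
  consider "?gs = 0" | w w' :: "'a list" where "length w = n" "neighbors w w'"
      "?gs = \<bar>int (length (compress W w)) - int (length (compress W w'))\<bar>"
    using global_sensitivity_attained(1) [of "compress W :: 'a list \<Rightarrow> bool list" n] by auto
  then show ?thesis
  proof cases
    case 1
    then show ?thesis using b lz77_bound_nonneg [of W] by simp
  next
    case 2
    then have "length w' = n" by (simp add: neighbors_def)
    with 2 have "?gs =
        real_of_int \<bar>(int (length (lz77_blocks W w)) - int (length (lz77_blocks W w'))) * ?b\<bar>"
      by (simp only: length_compress left_diff_distrib)
    also have "\<dots> = \<bar>real (length (lz77_blocks W w)) - real (length (lz77_blocks W w'))\<bar> * real_of_int ?b"
      using b by (simp add: abs_mult)
    also have "\<dots> \<le> lz77_bound W * real_of_int ?b"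
      using neighbors_lz77_blocks_diff_le [OF 2(2), of W]
        neighbors_lz77_blocks_diff_le [OF neighbors_sym [OF 2(2)], of W] b
      by (intro mult_right_mono) (auto simp: abs_le_iff)
    finally show ?thesis .
  qed
qed

text \<open>For \<open>W n \<ge> 1\<close> the power \<open>2/3\<close> dominates the lower-order
  terms; for \<open>n \<ge> 2\<close> the logarithm dominates the constant alphabet term.\<close>

lemma lz77_bound_bits_bigo:
  assumes "\<forall>\<^sub>F n in at_top. 1 \<le> W n"
  shows "(\<lambda>n. lz77_bound (W n) * real_of_int (2 * \<lceil>log 2 (real n)\<rceil> + \<lceil>log 2 (real m)\<rceil>))
    \<in> O(\<lambda>n. real (W n) powr (2/3) * log 2 (real n))"
proof (rule landau_o.big.mult)
  show "(\<lambda>n. lz77_bound (W n)) \<in> O(\<lambda>n. real (W n) powr (2/3))"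
  proof (rule landau_o.bigI [of "root 3 81 / 2 + root 3 9 / 2 + 3"])
    show "\<forall>\<^sub>F n in at_top. norm (lz77_bound (W n)) \<le>
        (root 3 81 / 2 + root 3 9 / 2 + 3) * norm (real (W n) powr (2/3))"
      using assms
    proof eventually_elim
      case (elim n)
      have "real (W n) powr (1/3) \<le> real (W n) powr (2/3)" "1 \<le> real (W n) powr (2/3)"
        using elim by (auto intro: powr_mono ge_one_powr_ge_zero)
      then have "lz77_bound (W n) \<le> root 3 81 / 2 * real (W n) powr (2/3)
          + root 3 9 / 2 * real (W n) powr (2/3) + 3 * real (W n) powr (2/3)"
        unfolding lz77_bound_def by (intro add_mono mult_left_mono) auto
      then show ?case using lz77_bound_nonneg [of "W n"] by (simp add: algebra_simps)
    qed
  qed (simp add: add_nonneg_pos)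
  \<comment> \<open>The \<open>4\<close> comes from \<lceil>x\<rceil> \<le> x + 1 \<le> 2 * x for x
    \<ge> 1, doubled.\<close>
  define C where "C = 4 + real_of_int \<lceil>log 2 (real m)\<rceil>"
  have C: "4 \<le> C" using ceiling_log_nonneg [of m] by (simp add: C_def)
  show "(\<lambda>n. real_of_int (2 * \<lceil>log 2 (real n)\<rceil> + \<lceil>log 2 (real m)\<rceil>)) \<in> O(\<lambda>n. log 2 (real n))"
  proof (rule landau_o.bigI [of C])
    show "\<forall>\<^sub>F n in at_top. norm (real_of_int (2 * \<lceil>log 2 (real n)\<rceil> + \<lceil>log 2 (real m)\<rceil>)) \<le>
        C * norm (log 2 (real n))"
      using eventually_ge_at_top [of 2]
    proof eventually_elim
      case (elim n)
      then have log: "1 \<le> log 2 (real n)" by simp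
      have "real_of_int (2 * \<lceil>log 2 (real n)\<rceil>) \<le> 4 * log 2 (real n)"
        using log by linarith
      moreover have "real_of_int \<lceil>log 2 (real m)\<rceil> * 1 \<le> real_of_int \<lceil>log 2 (real m)\<rceil> * log 2 (real n)"
        using log ceiling_log_nonneg [of m] by (intro mult_left_mono) auto
      ultimately show ?case
        using log ceiling_log_nonneg [of m] ceiling_log_nonneg [of n]
        by (simp add: C_def algebra_simps)
    qed
  qed (use C in simp)
qed

text \<open>In the asymptotic part the window may vary with \<open>n\<close>. At
  \<open>W n = 0\<close> the comparison function vanishes while the summand \<open>3\<close> of the
  explicit bound remains, hence \<open>1 \<le> W n\<close>.\<close>

theorem theorem4:
  shows "(\<forall>n W. W \<le> n \<longrightarrow>
      real_of_int (global_sensitivity (compress W :: 'a::finite list \<Rightarrow> bool list) n)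
        \<le> (root 3 81 / 2 * real W powr (2/3) + root 3 9 / 2 * real W powr (1/3) + 3)
           * real_of_int (2 * \<lceil>log 2 (real n)\<rceil> + \<lceil>log 2 (real CARD('a))\<rceil>))
    \<and> (\<forall>W. (\<forall>\<^sub>F n in at_top. 1 \<le> W n \<and> W n \<le> n) \<longrightarrow>
      (\<lambda>n. (root 3 81 / 2 * real (W n) powr (2/3) + root 3 9 / 2 * real (W n) powr (1/3) + 3)
           * real_of_int (2 * \<lceil>log 2 (real n)\<rceil> + \<lceil>log 2 (real CARD('a))\<rceil>))
        \<in> O(\<lambda>n. real (W n) powr (2/3) * log 2 (real n)) \<and>
      (\<lambda>n. real_of_int (global_sensitivity (compress (W n) :: 'a list \<Rightarrow> bool list) n))
        \<in> O(\<lambda>n. real (W n) powr (2/3) * log 2 (real n)))"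
proof (fold lz77_bound_def, intro conjI allI impI)
  fix n W :: nat
  show "real_of_int (global_sensitivity (compress W :: 'a list \<Rightarrow> bool list) n)
      \<le> lz77_bound W * real_of_int (2 * \<lceil>log 2 (real n)\<rceil> + \<lceil>log 2 (real CARD('a))\<rceil>)"
    by (rule global_sensitivity_compress_le)
next
  fix W :: "nat \<Rightarrow> nat"
  assume "\<forall>\<^sub>F n in at_top. 1 \<le> W n \<and> W n \<le> n"
  then have "\<forall>\<^sub>F n in at_top. 1 \<le> W n" by (rule eventually_mono) simp
  then show bigo: "(\<lambda>n. lz77_bound (W n) *
      real_of_int (2 * \<lceil>log 2 (real n)\<rceil> + \<lceil>log 2 (real CARD('a))\<rceil>))
      \<in> O(\<lambda>n. real (W n) powr (2/3) * log 2 (real n))"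
    by (rule lz77_bound_bits_bigo)
  have "(\<lambda>n. real_of_int (global_sensitivity (compress (W n) :: 'a list \<Rightarrow> bool list) n))
      \<in> O(\<lambda>n. lz77_bound (W n) * real_of_int (2 * \<lceil>log 2 (real n)\<rceil> + \<lceil>log 2 (real CARD('a))\<rceil>))"
  proof (rule landau_o.big_mono, rule always_eventually, rule allI)
    fix n
    show "norm (real_of_int (global_sensitivity (compress (W n) :: 'a list \<Rightarrow> bool list) n)) \<le>
      norm (lz77_bound (W n) * real_of_int (2 * \<lceil>log 2 (real n)\<rceil> + \<lceil>log 2 (real CARD('a))\<rceil>))"
      using global_sensitivity_compress_le [of "W n" n, where 'a = 'a]
        global_sensitivity_attained(2) [of "compress (W n) :: 'a list \<Rightarrow> bool list" n]
      by simp
  qed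
  from landau_o.big_trans [OF this bigo]
  show "(\<lambda>n. real_of_int (global_sensitivity (compress (W n) :: 'a list \<Rightarrow> bool list) n))
      \<in> O(\<lambda>n. real (W n) powr (2/3) * log 2 (real n))" .
qed

end
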